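(* Let $k$ be an infinite field and let $I$ be a nonzero componentwise linear monomial ideal in the standard graded polynomial ring $k[x,y]$. Then there exists an ordering $f_1,\dots,f_s$ of the minimal set of monomial generators of $I$ such that $\deg f_1\le\deg f_2\le\cdots\le\deg f_s$ and, for all $1\le j\le s-1$, $(f_1,\dots,f_j):f_{j+1}=(z_j)$, where each $z_j$ is a variable (i.e. $z_j\in\{x,y\}$).
   Context: For a homogeneous ideal $I$, $I_{\langle j\rangle}$ denotes the ideal generated by all forms of degree $j$ in $I$. A homogeneous ideal generated in a single degree $d$ has a linear resolution if its Castelnuovo-Mumford regularity is $d$ (the zero ideal is regarded as having a linear resolution). $I$ is componentwise linear if $I_{\langle j\rangle}$ has a linear resolution for all $j\ge 0$. *)

theory Defs
  imports
    "HOL-Library.Poly_Mapping"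
    "HOL-Library.Product_Plus"
    "Jordan_Normal_Form.Matrix_Kernel"
begin

section \<open>The polynomial ring in two variables\<close>

text \<open>The key \<open>(a, b)\<close> stands for the monomial \<open>x^a y^b\<close>; the ring structure is the convolution
  product of \<^theory>\<open>HOL-Library.Poly_Mapping\<close>.\<close>

type_synonym 'k poly2 = "(nat \<times> nat) \<Rightarrow>\<^sub>0 'k"

definition mon :: "nat \<times> nat \<Rightarrow> 'k::field poly2" where
  "mon t = Poly_Mapping.single t 1"

definition var_x :: "'k::field poly2" where "var_x = mon (1, 0)"
definition var_y :: "'k::field poly2" where "var_y = mon (0, 1)"

definition exp_deg :: "nat \<times> nat \<Rightarrow> nat" where
  "exp_deg t = fst t + snd t"

definition total_deg :: "'k::field poly2 \<Rightarrow> nat" where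
  "total_deg f = Max (insert 0 (exp_deg ` Poly_Mapping.keys f))"

text \<open>Forms of degree \<open>d\<close>; as usual \<open>0\<close> is a form of every degree.\<close>

definition form :: "nat \<Rightarrow> 'k::field poly2 \<Rightarrow> bool" where
  "form d f \<longleftrightarrow> (\<forall>t \<in> Poly_Mapping.keys f. exp_deg t = d)"

section \<open>Ideals\<close>

text \<open>Ideals are the submodules of the ring, regarded as a module over itself.\<close>

global_interpretation ideal: module "(*) :: 'a::comm_ring_1 \<Rightarrow> 'a \<Rightarrow> 'a"
  defines ideal_of = ideal.span
  by standard (simp_all add: algebra_simps)

definition ideal_colon :: "'a::comm_ring_1 set \<Rightarrow> 'a \<Rightarrow> 'a set" where
  "ideal_colon J f = {g. g * f \<in> J}"

definition homogeneous_ideal :: "'k::field poly2 set \<Rightarrow> bool" where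
  "homogeneous_ideal I \<longleftrightarrow> (\<exists>B. (\<forall>f\<in>B. \<exists>d. form d f) \<and> I = ideal_of B)"

definition generated_in_degree :: "nat \<Rightarrow> 'k::field poly2 set \<Rightarrow> bool" where
  "generated_in_degree d I \<longleftrightarrow> (\<exists>B. (\<forall>f\<in>B. form d f) \<and> I = ideal_of B)"

definition degree_component_ideal :: "'k::field poly2 set \<Rightarrow> nat \<Rightarrow> 'k poly2 set" where
  "degree_component_ideal I j = ideal_of {f \<in> I. form j f}"

definition monomial_ideal :: "'k::field poly2 set \<Rightarrow> bool" where
  "monomial_ideal I \<longleftrightarrow> (\<exists>T. I = ideal_of (mon ` T))"

definition minimal_monomial_generators :: "'k::field poly2 set \<Rightarrow> 'k poly2 set \<Rightarrow> bool" where
  "minimal_monomial_generators I G \<longleftrightarrow>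
     G \<subseteq> range mon \<and> ideal_of G = I \<and> (\<forall>G'. G' \<subset> G \<longrightarrow> ideal_of G' \<noteq> I)"

section \<open>Minimal graded free resolutions and Castelnuovo-Mumford regularity\<close>

text \<open>With \<open>S\<close> the polynomial ring, a list \<open>[d\<^sub>1, ..., d\<^sub>r]\<close> of natural numbers represents the graded
  free module \<open>S(-d\<^sub>1) \<oplus> ... \<oplus> S(-d\<^sub>r)\<close>, i.e. its entries are the degrees of the basis elements.
  Natural numbers suffice, since no basis element of a minimal resolution of an ideal has negative
  degree. A degree-0 homomorphism from the module given by \<open>ss\<close> to the one given by \<open>ts\<close> is a matrix
  acting on column vectors whose entry at \<open>(m, n)\<close> is a form of degree \<open>ss ! n - ts ! m\<close>
  (and \<open>0\<close> if that number is negative).\<close>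

definition graded_hom :: "nat list \<Rightarrow> nat list \<Rightarrow> 'k::field poly2 mat \<Rightarrow> bool" where
  "graded_hom ss ts A \<longleftrightarrow>
     A \<in> carrier_mat (length ts) (length ss) \<and>
     (\<forall>m < length ts. \<forall>n < length ss.
        \<forall>t \<in> Poly_Mapping.keys (A $$ (m, n)). exp_deg t + ts ! m = ss ! n)"

definition mat_image :: "'a::comm_ring_1 mat \<Rightarrow> 'a vec set" where
  "mat_image A = {A *\<^sub>v v | v. v \<in> carrier_vec (dim_col A)}"

text \<open>\<open>F i\<close> lists the basis degrees of the \<open>i\<close>-th free module, \<open>D 0\<close> is the augmentation
  \<open>F 0 \<rightarrow> I \<subseteq> S\<close> (a matrix with one row) and \<open>D (i + 1)\<close> is the differential from \<open>F (i + 1)\<close>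
  to \<open>F i\<close>. Minimality means that every differential maps into \<open>(x, y)\<close> times its
  target; it is not imposed on the augmentation. Finite resolutions have \<open>F i = []\<close> for large \<open>i\<close>.\<close>

definition minimal_graded_free_resolution ::
    "'k::field poly2 set \<Rightarrow> (nat \<Rightarrow> nat list) \<Rightarrow> (nat \<Rightarrow> 'k poly2 mat) \<Rightarrow> bool" where
  "minimal_graded_free_resolution I F D \<longleftrightarrow>
     graded_hom (F 0) [0] (D 0) \<and>
     (\<forall>i. graded_hom (F (Suc i)) (F i) (D (Suc i))) \<and>
     I = (\<lambda>v. v $ 0) ` mat_image (D 0) \<and>
     (\<forall>i. mat_kernel (D i) = mat_image (D (Suc i))) \<and>
     (\<forall>i. \<forall>m < length (F i). \<forall>n < length (F (Suc i)).
        D (Suc i) $$ (m, n) \<in> ideal_of {var_x, var_y})"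

text \<open>\<open>reg I = max {d - i | S(-d) is a summand of F i}\<close>, where \<open>F\<close> is the minimal graded free
  resolution of \<open>I\<close>. It is stated as a relation: every homogeneous ideal has a minimal graded free
  resolution, and the shifts do not depend on its choice, so a nonzero homogeneous ideal has exactly
  one regularity. The zero ideal has none.\<close>

definition has_regularity :: "'k::field poly2 set \<Rightarrow> int \<Rightarrow> bool" where
  "has_regularity I r \<longleftrightarrow>
     (\<exists>F D. minimal_graded_free_resolution I F D \<and>
        r \<in> {int d - int i | d i. d \<in> set (F i)} \<and>
        (\<forall>s \<in> {int d - int i | d i. d \<in> set (F i)}. s \<le> r))"

definition has_linear_resolution :: "'k::field poly2 set \<Rightarrow> bool" where
  "has_linear_resolution I \<longleftrightarrow>
     I = {0} \<or> (\<exists>d. generated_in_degree d I \<and> has_regularity I (int d))"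

definition componentwise_linear :: "'k::field poly2 set \<Rightarrow> bool" where
  "componentwise_linear I \<longleftrightarrow>
     homogeneous_ideal I \<and> (\<forall>j. has_linear_resolution (degree_component_ideal I j))"

end

theory Submission
  imports Defs
begin

text \<open>If an ideal generated by monomials of degree \<open>j\<close> has a linear resolution, then their
  \<open>x\<close>-exponents form an interval: all syzygies are generated by linear ones, which cannot link
  monomials on different sides of a gap. Hence in every degree the monomials of a componentwise
  linear monomial ideal \<open>I\<close> are consecutive. Take the minimal generators by increasing degree.
  In degree \<open>e\<close>, the monomials already generated form an interval inside that of \<open>I\<close>, and as long
  as it is smaller, one of the monomials just outside it is a minimal generator. Adding this
  generator keeps the interval connected, and its colon ideal is generated by the variable
  that moves it into the interval.\<close>

section \<open>Monomial ideals\<close>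

text \<open>Divisibility of monomials read off from exponents. By \<open>ideal_of_mon\<close> below,
  these are the exponents of the monomials in the ideal generated by the monomials of
  \<open>T\<close>.\<close>

definition upset :: "(nat \<times> nat) set \<Rightarrow> (nat \<times> nat) set" where
  "upset T = {t. \<exists>s\<in>T. fst s \<le> fst t \<and> snd s \<le> snd t}"

lemma subset_upset: "T \<subseteq> upset T"
  by (auto simp: upset_def)

lemma upset_mono: "S \<subseteq> T \<Longrightarrow> upset S \<subseteq> upset T"
  by (auto simp: upset_def)

lemma upset_closed: "s \<in> upset T \<Longrightarrow> fst s \<le> fst t \<Longrightarrow> snd s \<le> snd t \<Longrightarrow> t \<in> upset T"
  by (auto simp: upset_def intro: order.trans)

lemma upset_idem: "upset (upset T) = upset T"
  using subset_upset[of "upset T"] by (auto simp: upset_def[of "upset T"] intro: upset_closed)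

lemma keys_mon [simp]: "Poly_Mapping.keys (mon t :: 'k::field poly2) = {t}"
  by (simp add: mon_def)

lemma inj_mon: "inj (mon :: _ \<Rightarrow> 'k::field poly2)"
  by (rule injI) (metis keys_mon singleton_inject)

lemma total_deg_mon [simp]: "total_deg (mon t :: 'k::field poly2) = exp_deg t"
  by (simp add: total_deg_def)

lemma lookup_mult_mon:
  fixes f :: "'k::field poly2"
  shows "Poly_Mapping.lookup (f * mon t) (s + t) = Poly_Mapping.lookup f s"
proof -
  have "(\<Sum>q. Poly_Mapping.lookup (mon t :: 'k poly2) q when s + t = l + q) = (1 when l = s)" for l
  proof -
    have "(Poly_Mapping.lookup (mon t :: 'k poly2) q when s + t = l + q) = ((1 when l = s) when q = t)" for q
      by (auto simp: mon_def lookup_single when_def)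
    then show ?thesis by simp
  qed
  then have "Poly_Mapping.lookup (f * mon t) (s + t) =
      (\<Sum>l. Poly_Mapping.lookup f l * (1 when l = s))"
    by (simp add: lookup_mult)
  also have "\<dots> = (\<Sum>l. Poly_Mapping.lookup f l when l = s)"
    by (simp add: mult_when)
  finally show ?thesis by simp
qed

text \<open>A shift of exponents is injective, so no terms cancel and the inclusion of
  \<open>keys_mult\<close> becomes an equality.\<close>

lemma keys_mult_mon:
  fixes f :: "'k::field poly2"
  shows "Poly_Mapping.keys (f * mon t) = (\<lambda>s. s + t) ` Poly_Mapping.keys f"
proof
  show "Poly_Mapping.keys (f * mon t) \<subseteq> (\<lambda>s. s + t) ` Poly_Mapping.keys f"
    using keys_mult[of f "mon t"] by (simp only: keys_mon) blast
  show "(\<lambda>s. s + t) ` Poly_Mapping.keys f \<subseteq> Poly_Mapping.keys (f * mon t)"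
    by (auto simp: in_keys_iff lookup_mult_mon)
qed

text \<open>The right-hand side is an ideal containing the generators. Conversely, each of its
  elements is a sum of terms, and every term is a multiple of some generator.\<close>

lemma ideal_of_mon:
  "ideal_of (mon ` T) = {f :: 'k::field poly2. Poly_Mapping.keys f \<subseteq> upset T}"
proof (rule ideal.span_unique)
  show "mon ` T \<subseteq> {f :: 'k poly2. Poly_Mapping.keys f \<subseteq> upset T}"
    using subset_upset[of T] by auto
  show "ideal.subspace {f :: 'k poly2. Poly_Mapping.keys f \<subseteq> upset T}"
  proof (rule ideal.subspaceI)
    fix c f :: "'k poly2"
    assume f: "f \<in> {f. Poly_Mapping.keys f \<subseteq> upset T}"
    have "Poly_Mapping.keys (c * f) \<subseteq> upset T"
    proof
      fix t assume "t \<in> Poly_Mapping.keys (c * f)"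
      then obtain r s where "t = r + s" "s \<in> Poly_Mapping.keys f"
        using keys_mult[of c f] by blast
      with f show "t \<in> upset T"
        by (auto intro: upset_closed[of s])
    qed
    then show "c * f \<in> {f. Poly_Mapping.keys f \<subseteq> upset T}" by simp
  next
    fix f g :: "'k poly2"
    assume "f \<in> {f. Poly_Mapping.keys f \<subseteq> upset T}" "g \<in> {f. Poly_Mapping.keys f \<subseteq> upset T}"
    then show "f + g \<in> {f. Poly_Mapping.keys f \<subseteq> upset T}"
      using keys_add[of f g] by auto
  qed simp
next
  fix J :: "'k poly2 set"
  assume J: "mon ` T \<subseteq> J" "ideal.subspace J"
  show "{f. Poly_Mapping.keys f \<subseteq> upset T} \<subseteq> J"
  proof safe
    fix f :: "'k poly2" assume f: "Poly_Mapping.keys f \<subseteq> upset T"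
    have term_in: "Poly_Mapping.single t c \<in> J" if "t \<in> upset T" for t and c :: 'k
    proof -
      from that obtain s where s: "s \<in> T" "fst s \<le> fst t" "snd s \<le> snd t"
        by (auto simp: upset_def)
      then have "t - s + s = t" by (simp add: prod_eq_iff)
      then have "Poly_Mapping.single t c = Poly_Mapping.single (t - s) c * mon s"
        by (simp add: mon_def mult_single)
      then show ?thesis using J s ideal.subspace_scale by auto
    qed
    have "f = (\<Sum>t\<in>Poly_Mapping.keys f. Poly_Mapping.single t (Poly_Mapping.lookup f t))"
      by (rule poly_mapping_eqI)
        (simp add: lookup_sum lookup_single when_def in_keys_iff)
    also have "\<dots> \<in> J"
      using f term_in by (intro ideal.subspace_sum J(2)) auto
    finally show "f \<in> J" .
  qed
qed

lemma ideal_of_mon_eq_iff: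
  "ideal_of (mon ` S) = (ideal_of (mon ` T) :: 'k::field poly2 set) \<longleftrightarrow> upset S = upset T"
proof
  assume eq: "ideal_of (mon ` S) = (ideal_of (mon ` T) :: 'k poly2 set)"
  have "t \<in> upset S \<longleftrightarrow> (mon t :: 'k poly2) \<in> ideal_of (mon ` S)"
    "t \<in> upset T \<longleftrightarrow> (mon t :: 'k poly2) \<in> ideal_of (mon ` T)" for t
    by (simp_all add: ideal_of_mon)
  with eq show "upset S = upset T" by auto
qed (simp add: ideal_of_mon)

text \<open>Every monomial of a form in a monomial ideal again lies in the ideal and has the same
  degree, so the monomials of degree \<open>j\<close> already generate.\<close>

lemma degree_component_ideal_mon:
  "degree_component_ideal (ideal_of (mon ` T) :: 'k::field poly2 set) j =
     ideal_of (mon ` {t \<in> upset T. exp_deg t = j})"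
  (is "_ = ideal_of (mon ` ?A)")
proof -
  let ?B = "{f :: 'k poly2. f \<in> ideal_of (mon ` T) \<and> form j f}"
  have "mon ` ?A \<subseteq> ?B" by (auto simp: ideal_of_mon form_def)
  moreover have "?B \<subseteq> ideal_of (mon ` ?A)"
    using subset_upset[of ?A] by (auto simp: ideal_of_mon form_def)
  ultimately have "ideal.span ?B = ideal.span (mon ` ?A)"
    by (metis (no_types, lifting) ideal.span_eq ideal.span_superset order.trans)
  then show ?thesis by (simp add: degree_component_ideal_def)
qed

lemma ideal_colon_mon:
  "ideal_colon (ideal_of (mon ` T)) (mon t :: 'k::field poly2) =
     {g. \<forall>s\<in>Poly_Mapping.keys g. s + t \<in> upset T}"
  by (auto simp: ideal_colon_def ideal_of_mon keys_mult_mon)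

section \<open>Linear resolutions\<close>

text \<open>In a fixed degree a monomial is determined by its \<open>x\<close>-exponent; the
  condition says that the \<open>x\<close>-exponents occurring in degree \<open>d\<close> form an
  interval.\<close>

definition gapfree :: "nat \<Rightarrow> (nat \<times> nat) set \<Rightarrow> bool" where
  "gapfree d U \<longleftrightarrow> (\<forall>s t u. exp_deg s = d \<longrightarrow> exp_deg t = d \<longrightarrow> exp_deg u = d \<longrightarrow>
     fst s < fst t \<longrightarrow> fst t < fst u \<longrightarrow> s \<in> U \<longrightarrow> u \<in> U \<longrightarrow> t \<in> U)"

text \<open>This map is additive but does not commute with multiplication by \<open>x\<close>. It is
  therefore applied to the entries of a matrix, not to its values.\<close>

definition truncate_x :: "nat \<Rightarrow> 'k::field poly2 \<Rightarrow> 'k poly2" where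
  "truncate_x b f = Poly_Mapping.mapp (\<lambda>t c. c when fst t < b) f"

lemma lookup_truncate_x:
  "Poly_Mapping.lookup (truncate_x b f) t = (Poly_Mapping.lookup f t when fst t < b)"
  by (auto simp: truncate_x_def mapp.rep_eq when_def in_keys_iff)

lemma keys_truncate_x:
  "Poly_Mapping.keys (truncate_x b f) = {t \<in> Poly_Mapping.keys f. fst t < b}"
  by (auto simp: in_keys_iff lookup_truncate_x)

lemma keys_minus_truncate_x:
  "Poly_Mapping.keys (f - truncate_x b f) = {t \<in> Poly_Mapping.keys f. b \<le> fst t}"
  by (auto simp: in_keys_iff lookup_truncate_x lookup_minus when_def not_less split: if_splits)

lemma keys_mult_mat_vec:
  fixes A :: "'k::field poly2 mat"
  assumes "A \<in> carrier_mat r n" "v \<in> carrier_vec n" "i < r"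
    and t: "t \<in> Poly_Mapping.keys ((A *\<^sub>v v) $ i)"
  obtains m p q where "m < n" "p \<in> Poly_Mapping.keys (A $$ (i, m))"
    "q \<in> Poly_Mapping.keys (v $ m)" "t = p + q"
proof -
  have "(A *\<^sub>v v) $ i = (\<Sum>m<n. A $$ (i, m) * v $ m)"
    using assms by (simp add: scalar_prod_def atLeast0LessThan)
  then have "t \<in> (\<Union>m<n. Poly_Mapping.keys (A $$ (i, m) * v $ m))"
    using t keys_sum[of "\<lambda>m. A $$ (i, m) * v $ m" "{..<n}"] by auto
  then obtain m where m: "m < n" "t \<in> Poly_Mapping.keys (A $$ (i, m) * v $ m)" by auto
  then show ?thesis using keys_mult[of "A $$ (i, m)" "v $ m"] that by blast
qed

text \<open>If \<open>x^b y^(j - b)\<close> is a gap, then cutting every entry of \<open>D 0\<close> at \<open>x\<close>-exponent \<open>b\<close> yields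
  a matrix that still annihilates the linear syzygies, hence all syzygies. It does not
  annihilate the syzygy between two monomials on different sides of the gap.\<close>

lemma gapfree_if_linear_resolution:
  fixes K :: "'k::field poly2 set"
  assumes K: "K = ideal_of (mon ` A)" and deg_A: "\<And>t. t \<in> A \<Longrightarrow> exp_deg t = j"
    and lin: "has_linear_resolution K"
  shows "gapfree j A"
  unfolding gapfree_def
proof (intro allI impI, rule ccontr)
  fix ta tb tc
  assume deg: "exp_deg ta = j" "exp_deg tb = j" "exp_deg tc = j"
    and lt: "fst ta < fst tb" "fst tb < fst tc"
    and A: "ta \<in> A" "tc \<in> A" "tb \<notin> A"
  define b where "b = fst tb"
  \<comment> \<open>Serves as the row bound for matrices with one row in
    \<open>keys_mult_mat_vec\<close>.\<close>
  have zero_less_1: "0 < (1 :: nat)" by simp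
  have eq_if: "s = t" if "exp_deg s = j" "exp_deg t = j" "fst s = fst t" for s t :: "nat \<times> nat"
    using that by (auto simp: exp_deg_def prod_eq_iff)
  have K_deg: "j \<le> exp_deg t" if "f \<in> K" "t \<in> Poly_Mapping.keys f" for f t
  proof -
    have "t \<in> upset A" using that by (auto simp: K ideal_of_mon)
    then obtain s where "s \<in> A" "fst s \<le> fst t" "snd s \<le> snd t" by (auto simp: upset_def)
    then show ?thesis using deg_A[of s] by (auto simp: exp_deg_def)
  qed
  have K_key: "t \<in> A" if "f \<in> K" "t \<in> Poly_Mapping.keys f" "exp_deg t = j" for f t
  proof -
    have "t \<in> upset A" using that by (auto simp: K ideal_of_mon)
    then obtain s where s: "s \<in> A" "fst s \<le> fst t" "snd s \<le> snd t" by (auto simp: upset_def)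
    then have "s = t" using deg_A[of s] that by (auto simp: exp_deg_def prod_eq_iff)
    with s show ?thesis by simp
  qed
  have mon_K: "mon ta \<in> K" "mon tc \<in> K"
    using A subset_upset[of A] by (auto simp: K ideal_of_mon)
  have "mon ta \<noteq> (0 :: 'k poly2)" by (metis keys_mon keys_zero insert_not_empty)
  then have "K \<noteq> {0}" using mon_K by auto
  with lin obtain d where gen: "generated_in_degree d K" and reg: "has_regularity K (int d)"
    by (auto simp: has_linear_resolution_def)
  \<comment> \<open>\<open>d\<close> comes from the linear resolution, \<open>j\<close> from
    \<open>A\<close>. All terms of elements of \<open>K\<close> have degree at least
    \<open>d\<close>, and \<open>mon ta\<close> has degree \<open>j\<close>.\<close>
  have "d \<le> j"
  proof -
    obtain B where B: "\<forall>f\<in>B. form d f" "K = ideal_of B"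
      using gen by (auto simp: generated_in_degree_def)
    let ?J = "ideal_of (mon ` {t. exp_deg t = d}) :: 'k poly2 set"
    have "B \<subseteq> ?J"
      using B(1) subset_upset[of "{t. exp_deg t = d}"] by (auto simp: ideal_of_mon form_def)
    then have "K \<subseteq> ?J"
      unfolding B(2) by (metis ideal.span_minimal ideal.subspace_span)
    with mon_K have "ta \<in> upset {t. exp_deg t = d}" by (auto simp: ideal_of_mon)
    then show ?thesis using deg by (auto simp: upset_def exp_deg_def)
  qed
  obtain F D where res: "minimal_graded_free_resolution K F D"
    and "\<forall>s \<in> {int d - int i | d i. d \<in> set (F i)}. s \<le> int d"
    using reg by (auto simp: has_regularity_def)
  \<comment> \<open>Used for \<open>i = 0\<close> and \<open>i = 1\<close>: generators have degree
    at most \<open>j\<close>, first syzygies at most \<open>j + 1\<close>.\<close>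
  then have bound: "e \<le> i + j" if "e \<in> set (F i)" for e i
    using that \<open>d \<le> j\<close> by fastforce
  define n m where "n = length (F 0)" and "m = length (F 1)"
  have hom0: "graded_hom (F 0) [0] (D 0)" and hom1: "graded_hom (F 1) (F 0) (D 1)"
    and img: "K = (\<lambda>v. v $ 0) ` mat_image (D 0)" and ker: "mat_kernel (D 0) = mat_image (D 1)"
    using res by (auto simp: minimal_graded_free_resolution_def)
  have D0: "D 0 \<in> carrier_mat 1 n" and D1: "D 1 \<in> carrier_mat n m"
    using hom0 hom1 by (auto simp: graded_hom_def n_def m_def)
  have D0_K: "D 0 $$ (0, i) \<in> K" if "i < n" for i
  proof -
    have "(D 0 *\<^sub>v unit_vec n i) $ 0 = D 0 $$ (0, i)" using D0 that by simp
    moreover have "D 0 *\<^sub>v unit_vec n i \<in> mat_image (D 0)" using D0 by (auto simp: mat_image_def)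
    ultimately show ?thesis unfolding img by (metis imageI)
  qed
  \<comment> \<open>A nonzero entry has degree at most \<open>j\<close> by \<open>bound\<close> and
    at least \<open>j\<close> because it lies in \<open>K\<close>. An \<open>x\<close>-exponent
    \<open>b\<close> would put \<open>tb\<close> into \<open>A\<close>.\<close>
  have D0_key: "exp_deg t = j \<and> F 0 ! i = j \<and> fst t \<noteq> b"
    if "i < n" "t \<in> Poly_Mapping.keys (D 0 $$ (0, i))" for i t
  proof -
    have "exp_deg t = F 0 ! i" using hom0 that by (auto simp: graded_hom_def n_def)
    moreover have "F 0 ! i \<le> j" using bound[of "F 0 ! i" 0] that by (simp add: n_def)
    moreover have "j \<le> exp_deg t" using K_deg D0_K that by blast
    moreover have "fst t \<noteq> b" if "exp_deg t = j"
      using K_key[OF D0_K[OF \<open>i < n\<close>] _ that] \<open>t \<in> _\<close> A(3) eq_if[OF that deg(2)] by (auto simp: b_def)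
    ultimately show ?thesis by auto
  qed
  define L where "L = mat 1 n (\<lambda>(r, i). truncate_x b (D 0 $$ (r, i)))"
  define R where "R = mat 1 n (\<lambda>(r, i). D 0 $$ (r, i) - truncate_x b (D 0 $$ (r, i)))"
  have L: "L \<in> carrier_mat 1 n" and R: "R \<in> carrier_mat 1 n" by (auto simp: L_def R_def)
  have "D 0 = L + R" using D0 by (intro eq_matI) (auto simp: L_def R_def)
  then have split: "D 0 *\<^sub>v v = L *\<^sub>v v + R *\<^sub>v v" if "v \<in> carrier_vec n" for v
    using add_mult_distrib_mat_vec[OF L R that] by simp
  have L_key: "exp_deg t = j \<and> F 0 ! i = j \<and> fst t < b"
    if "i < n" "t \<in> Poly_Mapping.keys (L $$ (0, i))" for i t
    using that D0_key[of i t] by (auto simp: L_def keys_truncate_x)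
  have R_key: "exp_deg t = j \<and> F 0 ! i = j \<and> b < fst t"
    if "i < n" "t \<in> Poly_Mapping.keys (R $$ (0, i))" for i t
    using that D0_key[of i t] by (auto simp: R_def keys_minus_truncate_x)
  \<comment> \<open>For a column \<open>v\<close> of \<open>D 1\<close>, \<open>L v = - R v\<close>,
    so a term of \<open>L v\<close> also occurs in \<open>R v\<close>. As the relevant entries of
    \<open>v\<close> have degree at most 1, its \<open>x\<close>-exponent is at most
    \<open>(b - 1) + 1 = b\<close>; seen from \<open>R\<close> it exceeds \<open>b\<close>.\<close>
  have L_col: "(L *\<^sub>v col (D 1) c) $ 0 = 0" if c: "c < m" for c
  proof (rule ccontr)
    let ?v = "col (D 1) c"
    have v: "?v \<in> carrier_vec n" using D1 by auto
    have entry_deg: "exp_deg q \<le> 1" if "i < n" "F 0 ! i = j" "q \<in> Poly_Mapping.keys (?v $ i)" for i q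
    proof -
      have "q \<in> Poly_Mapping.keys (D 1 $$ (i, c))" using that D1 c by auto
      then have "exp_deg q + F 0 ! i = F 1 ! c"
        using hom1 that c by (auto simp: graded_hom_def n_def m_def)
      moreover have "F 1 ! c \<le> 1 + j" using bound[of "F 1 ! c" 1] c by (simp add: m_def)
      ultimately show ?thesis using that by simp
    qed
    assume "(L *\<^sub>v ?v) $ 0 \<noteq> 0"
    then obtain t where t: "t \<in> Poly_Mapping.keys ((L *\<^sub>v ?v) $ 0)"
      by (metis keys_eq_empty equals0I)
    have "?v = D 1 *\<^sub>v unit_vec m c" using D1 c by (auto intro!: eq_vecI)
    then have "?v \<in> mat_kernel (D 0)" using D1 unfolding ker by (auto simp: mat_image_def)
    then have "D 0 *\<^sub>v ?v = 0\<^sub>v 1" using mat_kernelD[OF D0] by blast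
    then have "(L *\<^sub>v ?v + R *\<^sub>v ?v) $ 0 = 0" unfolding split[OF v] by simp
    then have "(L *\<^sub>v ?v) $ 0 + (R *\<^sub>v ?v) $ 0 = 0" using R by (subst (asm) index_add_vec) auto
    then have "(R *\<^sub>v ?v) $ 0 = - ((L *\<^sub>v ?v) $ 0)" by (simp add: add_eq_0_iff)
    then have t': "t \<in> Poly_Mapping.keys ((R *\<^sub>v ?v) $ 0)" using t by simp
    obtain i p q where l: "i < n" "p \<in> Poly_Mapping.keys (L $$ (0, i))"
      "q \<in> Poly_Mapping.keys (?v $ i)" "t = p + q"
      by (rule keys_mult_mat_vec[OF L v zero_less_1 t])
    have "fst t \<le> b" using L_key[OF l(1,2)] entry_deg[OF l(1) _ l(3)] l(4) by (auto simp: exp_deg_def)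
    moreover obtain i p q where r: "i < n" "p \<in> Poly_Mapping.keys (R $$ (0, i))" "t = p + q"
      by (rule keys_mult_mat_vec[OF R v zero_less_1 t'])
    have "b < fst t" using R_key[OF r(1,2)] r(3) by auto
    ultimately show False by simp
  qed
  have "L * D 1 = 0\<^sub>m 1 m"
  proof (rule eq_matI)
    fix r c assume "r < dim_row (0\<^sub>m 1 m :: 'k poly2 mat)" "c < dim_col (0\<^sub>m 1 m :: 'k poly2 mat)"
    then show "(L * D 1) $$ (r, c) = 0\<^sub>m 1 m $$ (r, c)" using L_col[of c] L D1 by simp
  qed (use L D1 in auto)
  \<comment> \<open>By exactness the columns of \<open>D 1\<close> generate all syzygies.\<close>
  then have L_ker: "(L *\<^sub>v v) $ 0 = 0" if v: "v \<in> mat_kernel (D 0)" for v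
  proof -
    obtain w where w: "w \<in> carrier_vec m" "v = D 1 *\<^sub>v w"
      using v D1 unfolding ker mat_image_def by auto
    have "L *\<^sub>v v = (L * D 1) *\<^sub>v w" using w assoc_mult_mat_vec[OF L D1] by simp
    also have "\<dots> = 0\<^sub>v 1" unfolding \<open>L * D 1 = 0\<^sub>m 1 m\<close> using w by (intro eq_vecI) auto
    finally show ?thesis by simp
  qed
  \<comment> \<open>In degree \<open>j\<close> only the constant terms of \<open>v\<close>
    contribute, so nothing is carried across the gap and \<open>L\<close> acts as truncation of the
    value.\<close>
  have L_lookup: "Poly_Mapping.lookup ((L *\<^sub>v v) $ 0) t =
      (Poly_Mapping.lookup ((D 0 *\<^sub>v v) $ 0) t when fst t < b)"
    if v: "v \<in> carrier_vec n" and t: "exp_deg t = j" for v t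
  proof -
    have "fst t < b" if key: "t \<in> Poly_Mapping.keys ((L *\<^sub>v v) $ 0)"
    proof -
      obtain i p q where l: "i < n" "p \<in> Poly_Mapping.keys (L $$ (0, i))" "t = p + q"
        using keys_mult_mat_vec[OF L v zero_less_1 key] by metis
      then have "q = 0" using L_key[of i p] t by (auto simp: exp_deg_def prod_eq_iff)
      then show ?thesis using L_key l by auto
    qed
    moreover have "b < fst t" if key: "t \<in> Poly_Mapping.keys ((R *\<^sub>v v) $ 0)"
    proof -
      obtain i p q where r: "i < n" "p \<in> Poly_Mapping.keys (R $$ (0, i))" "t = p + q"
        using keys_mult_mat_vec[OF R v zero_less_1 key] by metis
      then show ?thesis using R_key[of i p] by auto
    qed
    moreover have "Poly_Mapping.lookup ((D 0 *\<^sub>v v) $ 0) t =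
        Poly_Mapping.lookup ((L *\<^sub>v v) $ 0) t + Poly_Mapping.lookup ((R *\<^sub>v v) $ 0) t"
      using split[OF v] L R by (simp add: lookup_add)
    ultimately show ?thesis by (cases "fst t < b") (fastforce simp: in_keys_iff)+
  qed
  have "\<exists>u \<in> carrier_vec n. (D 0 *\<^sub>v u) $ 0 = f" if "f \<in> K" for f
    using that D0 unfolding img mat_image_def by auto
  then obtain ua uc where u: "ua \<in> carrier_vec n" "uc \<in> carrier_vec n"
    and D0_u: "(D 0 *\<^sub>v ua) $ 0 = mon ta" "(D 0 *\<^sub>v uc) $ 0 = mon tc"
    using mon_K by meson
  \<comment> \<open>Since \<open>ta\<close> and \<open>tc\<close> have equal degree, multiplying by
    \<open>x^h\<close> and \<open>y^h\<close> respectively leads to the same monomial;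
    \<open>w\<close> lifts this relation to a syzygy on the generators.\<close>
  define h where "h = fst tc - fst ta"
  have tac: "ta + (h, 0) = tc + (0, h)"
    using deg lt by (auto simp: h_def exp_deg_def prod_eq_iff)
  define w :: "'k poly2 vec" where "w = mon (h, 0) \<cdot>\<^sub>v ua - mon (0, h) \<cdot>\<^sub>v uc"
  have w: "w \<in> carrier_vec n" using u by (simp add: w_def)
  have lin_w: "(M *\<^sub>v w) $ 0 = (M *\<^sub>v ua) $ 0 * mon (h, 0) - (M *\<^sub>v uc) $ 0 * mon (0, h)"
    if M: "M \<in> carrier_mat 1 n" for M
  proof -
    have "row M 0 \<in> carrier_vec n" using M by auto
    then have "row M 0 \<bullet> w = row M 0 \<bullet> (mon (h, 0) \<cdot>\<^sub>v ua) - row M 0 \<bullet> (mon (0, h) \<cdot>\<^sub>v uc)"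
      unfolding w_def using u by (intro scalar_prod_minus_distrib) auto
    then show ?thesis using M u by (simp add: mult.commute)
  qed
  have "(D 0 *\<^sub>v w) $ 0 = 0"
    unfolding lin_w[OF D0] D0_u by (simp add: mon_def mult_single tac)
  then have "D 0 *\<^sub>v w = 0\<^sub>v 1" using D0 by (intro eq_vecI) auto
  then have "w \<in> mat_kernel (D 0)" using D0 w by (intro mat_kernelI)
  then have "(L *\<^sub>v ua) $ 0 * mon (h, 0) = (L *\<^sub>v uc) $ 0 * mon (0, h)"
    using L_ker lin_w[OF L] by simp
  \<comment> \<open>Compare coefficients at the common multiple. The left one is 1, as
    \<open>ta\<close> lies left of the gap; the right one is 0, as \<open>tc\<close> lies right of
    it.\<close>
  then have "Poly_Mapping.lookup ((L *\<^sub>v ua) $ 0) ta = Poly_Mapping.lookup ((L *\<^sub>v uc) $ 0) tc"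
    by (metis lookup_mult_mon tac)
  moreover have "Poly_Mapping.lookup ((L *\<^sub>v ua) $ 0) ta = 1"
    using L_lookup[OF u(1) deg(1)] lt by (simp add: D0_u b_def) (simp add: mon_def)
  moreover have "Poly_Mapping.lookup ((L *\<^sub>v uc) $ 0) tc = 0"
    using L_lookup[OF u(2) deg(3)] lt by (simp add: b_def)
  ultimately show False by simp
qed

section \<open>Staircases\<close>

lemma exp_deg_eqI: "exp_deg s = exp_deg t \<Longrightarrow> fst s = fst t \<Longrightarrow> s = t"
  by (auto simp: exp_deg_def prod_eq_iff)

lemma gapfreeD:
  "gapfree d U \<Longrightarrow> s \<in> U \<Longrightarrow> u \<in> U \<Longrightarrow> exp_deg s = d \<Longrightarrow> exp_deg t = d \<Longrightarrow> exp_deg u = d \<Longrightarrow>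
     fst s < fst t \<Longrightarrow> fst t < fst u \<Longrightarrow> t \<in> U"
  unfolding gapfree_def by blast

text \<open>With no generators above degree \<open>d\<close>, every monomial of degree
  \<open>d + 1\<close> is \<open>x\<close> or \<open>y\<close> times one of degree \<open>d\<close>,
  so the interval merely grows by one step.\<close>

lemma gapfree_upset_Suc:
  assumes gap: "gapfree d (upset P)" and deg: "\<And>r. r \<in> P \<Longrightarrow> exp_deg r \<le> d"
  shows "gapfree (Suc d) (upset P)"
  unfolding gapfree_def
proof (intro allI impI)
  have pred: "\<exists>t'\<in>upset P. exp_deg t' = d \<and> fst t' \<le> fst t \<and> snd t' \<le> snd t"
    if "t \<in> upset P" "exp_deg t = Suc d" for t
  proof -
    from that obtain r where r: "r \<in> P" "fst r \<le> fst t" "snd r \<le> snd t" by (auto simp: upset_def)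
    show ?thesis
    proof (cases "fst r < fst t")
      case True
      with r that have "(fst t - 1, snd t) \<in> upset P" "exp_deg (fst t - 1, snd t) = d"
        by (auto simp: exp_deg_def intro!: upset_closed[OF subsetD[OF subset_upset], of r])
      then show ?thesis by (intro bexI[of _ "(fst t - 1, snd t)"]) auto
    next
      case False
      with r that deg[of r] have "snd r < snd t" by (auto simp: exp_deg_def)
      with r that have "(fst t, snd t - 1) \<in> upset P" "exp_deg (fst t, snd t - 1) = d"
        by (auto simp: exp_deg_def intro!: upset_closed[OF subsetD[OF subset_upset], of r])
      then show ?thesis by (intro bexI[of _ "(fst t, snd t - 1)"]) auto
    qed
  qed
  fix s t u
  assume d: "exp_deg s = Suc d" "exp_deg t = Suc d" "exp_deg u = Suc d"
    and lt: "fst s < fst t" "fst t < fst u" and su: "s \<in> upset P" "u \<in> upset P"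
  obtain s' where s': "s' \<in> upset P" "exp_deg s' = d" "fst s' \<le> fst s" "snd s' \<le> snd s"
    using pred[OF su(1) d(1)] by auto
  obtain u' where u': "u' \<in> upset P" "exp_deg u' = d" "fst u' \<le> fst u" "snd u' \<le> snd u"
    using pred[OF su(2) d(3)] by auto
  \<comment> \<open>Division of \<open>t\<close> by \<open>y\<close>, possible since
    \<open>t\<close> lies left of \<open>u\<close>. The result lies right of \<open>s'\<close> and
    not beyond \<open>u'\<close>, because \<open>fst u' \<ge> fst u - 1\<close>.\<close>
  define t' where "t' = (fst t, snd t - 1)"
  have t': "exp_deg t' = d" using d lt by (auto simp: t'_def exp_deg_def)
  have "t' \<in> upset P"
  proof (cases "fst u' = fst t")
    case True
    with u' t' have "u' = t'" by (intro exp_deg_eqI) (auto simp: t'_def)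
    with u' show ?thesis by simp
  next
    case False
    then have "fst t' < fst u'" using u' d lt by (auto simp: t'_def exp_deg_def)
    with lt s' show ?thesis
      by (intro gapfreeD[OF gap s'(1) u'(1) s'(2) t' u'(2)]) (auto simp: t'_def)
  qed
  then show "t \<in> upset P" by (rule upset_closed) (auto simp: t'_def)
qed

lemma gapfree_upset_mono:
  assumes "d \<le> e" "gapfree d (upset P)" "\<And>r. r \<in> P \<Longrightarrow> exp_deg r \<le> d"
  shows "gapfree e (upset P)"
  using assms
proof (induction e rule: dec_induct)
  case (step e)
  then show ?case using le_trans by (intro gapfree_upset_Suc) blast+
qed

text \<open>\<open>P\<close> holds the generators taken so far. The first monomial \<open>h\<close>
  right of \<open>p\<close> outside \<open>upset P\<close> lies between \<open>p\<close> and
  \<open>a\<close>, hence in \<open>upset M\<close>. A generator dividing it is not in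
  \<open>P\<close>, so has degree at least \<open>e\<close> and equals \<open>h\<close>.\<close>

lemma extend_right:
  assumes gap_M: "gapfree e (upset M)" and gap_P: "gapfree e (upset P)" and "P \<subseteq> M"
    and rest: "\<And>m. m \<in> M - P \<Longrightarrow> e \<le> exp_deg m" and deg_P: "\<And>r. r \<in> P \<Longrightarrow> exp_deg r \<le> e"
    and p: "p \<in> upset P" "exp_deg p = e"
    and a: "a \<in> M" "a \<notin> upset P" "exp_deg a = e" and "fst p < fst a"
  obtains h where "h \<in> M" "h \<notin> P" "exp_deg h = e" "gapfree e (upset (insert h P))"
    "\<And>s. s + h \<in> upset P \<longleftrightarrow> 1 \<le> snd s"
proof -
  \<comment> \<open>The bound \<open>q \<le> e\<close> makes \<open>e - q\<close> a true
    difference.\<close>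
  define Q where "Q q \<longleftrightarrow> fst p < q \<and> q \<le> e \<and> (q, e - q) \<notin> upset P" for q
  have a_eq: "(fst a, e - fst a) = a" using a by (auto simp: exp_deg_def prod_eq_iff)
  have "fst a \<le> e" using a by (auto simp: exp_deg_def)
  then have "Q (fst a)" using a \<open>fst p < fst a\<close> by (simp add: Q_def a_eq)
  define q where "q = (LEAST q. Q q)"
  have least: "\<not> Q q'" if "q' < q" for q'
    using that unfolding q_def by (rule not_less_Least)
  have "Q q" "q \<le> fst a" using \<open>Q (fst a)\<close> unfolding q_def by (auto intro: LeastI Least_le)
  define h where "h = (q, e - q)"
  have h: "fst p < fst h" "exp_deg h = e" "h \<notin> upset P" and fst_h: "fst h = q"
    using \<open>Q q\<close> by (auto simp: Q_def h_def exp_deg_def)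
  have "h \<in> upset M"
  proof (cases "q = fst a")
    case True
    then have "h = a" using a_eq by (simp add: h_def)
    then show ?thesis using a subset_upset by auto
  next
    case False
    then show ?thesis
      using gapfreeD[OF gap_M _ _ p(2) h(2) a(3) h(1)] p(1) upset_mono[OF \<open>P \<subseteq> M\<close>] a(1)
        subset_upset[of M] \<open>q \<le> fst a\<close> fst_h by auto
  qed
  then obtain m where m: "m \<in> M" "fst m \<le> fst h" "snd m \<le> snd h" by (auto simp: upset_def)
  then have "m \<notin> P" using h(3) by (auto simp: upset_def)
  then have "e \<le> exp_deg m" using rest m by simp
  then have "m = h" using m h(2) by (auto simp: exp_deg_def prod_eq_iff)
  then have "h \<in> M" "h \<notin> P" using m \<open>m \<notin> P\<close> by auto
  \<comment> \<open>The left neighbour of \<open>h\<close> is \<open>p\<close> itself or was passed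
    over by the minimality of \<open>q\<close>. It shows that \<open>y\<close> times
    \<open>h\<close> lies in \<open>upset P\<close>.\<close>
  have prev: "(q - 1, Suc (e - q)) \<in> upset P"
  proof (cases "q - 1 = fst p")
    case True
    then have "p = (q - 1, Suc (e - q))"
      using p(2) h(1) \<open>Q q\<close> by (auto simp: Q_def exp_deg_def prod_eq_iff)
    then show ?thesis using p(1) by simp
  next
    case False
    then have "fst p < q - 1" "q - 1 < q" using h(1) fst_h by auto
    then have "(q - 1, e - (q - 1)) \<in> upset P"
      using least[of "q - 1"] \<open>Q q\<close> by (auto simp: Q_def)
    moreover have "e - (q - 1) = Suc (e - q)" using \<open>Q q\<close> by (auto simp: Q_def)
    ultimately show ?thesis by metis
  qed
  \<comment> \<open>A monomial of \<open>upset P\<close> to the right of \<open>h\<close> would,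
    together with \<open>p\<close>, force \<open>h\<close> into the interval.\<close>
  have out: "fst r < q" if "r \<in> upset P" "exp_deg r = e" for r
  proof (rule ccontr)
    assume "\<not> fst r < q"
    then consider "fst r = q" | "fst h < fst r" using fst_h by linarith
    then show False
    proof cases
      case 1
      then have "r = h" using that h fst_h by (intro exp_deg_eqI) auto
      then show False using that h by simp
    next
      case 2
      then show False using gapfreeD[OF gap_P p(1) that(1) p(2) h(2) that(2) h(1)] h(3) by simp
    qed
  qed
  have colon: "s + h \<in> upset P \<longleftrightarrow> 1 \<le> snd s" for s
  proof
    assume "1 \<le> snd s"
    then show "s + h \<in> upset P" by (intro upset_closed[OF prev]) (auto simp: h_def)
  next
    assume "s + h \<in> upset P"
    then obtain r where r: "r \<in> P" "fst r \<le> fst s + q" "snd r \<le> snd s + (e - q)"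
      by (auto simp: upset_def h_def)
    \<comment> \<open>Otherwise a generator \<open>r\<close> divides \<open>h\<close> times a power
      of \<open>x\<close>. Raising \<open>r\<close> to degree \<open>e\<close> by a power of
      \<open>x\<close> gives a monomial at or right of \<open>h\<close>, against
      \<open>out\<close>.\<close>
    show "1 \<le> snd s"
    proof (rule ccontr)
      assume "\<not> 1 \<le> snd s"
      then have "snd r \<le> e - q" using r by simp
      moreover have "fst r \<le> e - snd r" "snd r \<le> e" using deg_P[OF r(1)] by (auto simp: exp_deg_def)
      moreover have "(e - snd r, snd r) \<in> upset P" "exp_deg (e - snd r, snd r) = e"
        using r(1) calculation by (auto simp: upset_def exp_deg_def)
      ultimately show False using out[of "(e - snd r, snd r)"] \<open>Q q\<close> by (auto simp: Q_def)
    qed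
  qed
  have new: "t \<in> upset (insert h P) \<longleftrightarrow> t \<in> upset P \<or> t = h" if "exp_deg t = e" for t
    using that h(2) by (auto simp: upset_def exp_deg_def prod_eq_iff)
  have "gapfree e (upset (insert h P))"
    unfolding gapfree_def
  proof (intro allI impI)
    fix s t u
    assume d: "exp_deg s = e" "exp_deg t = e" "exp_deg u = e" and lt: "fst s < fst t" "fst t < fst u"
      and su: "s \<in> upset (insert h P)" "u \<in> upset (insert h P)"
    have "fst u \<le> q" using su(2) new[OF d(3)] out[of u] d(3) fst_h by auto
    then have s: "s \<in> upset P" using su(1) new[OF d(1)] lt fst_h by auto
    \<comment> \<open>Now \<open>t\<close> is left of \<open>h\<close>: between \<open>p\<close> and
      \<open>h\<close> the minimality of \<open>q\<close> applies, left of \<open>p\<close> the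
      interval property of \<open>P\<close>.\<close>
    have "t \<in> upset P"
    proof (cases "fst p < fst t")
      case True
      then have "(fst t, e - fst t) \<in> upset P"
        using least[of "fst t"] lt \<open>fst u \<le> q\<close> d(2) by (auto simp: Q_def exp_deg_def)
      moreover have "(fst t, e - fst t) = t" using d(2) by (auto simp: exp_deg_def prod_eq_iff)
      ultimately show ?thesis by simp
    next
      case False
      then consider "fst t = fst p" | "fst t < fst p" by linarith
      then show ?thesis
      proof cases
        case 1
        then have "t = p" using d p by (intro exp_deg_eqI) auto
        then show ?thesis using p by simp
      next
        case 2
        then show ?thesis using gapfreeD[OF gap_P s p(1) d(1,2) p(2) lt(1)] by simp
      qed
    qed
    then show "t \<in> upset (insert h P)" using new[OF d(2)] by simp
  qed
  then show ?thesis using that \<open>h \<in> M\<close> \<open>h \<notin> P\<close> h(2) colon by blast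
qed

section \<open>Symmetry under exchanging the two variables\<close>

lemma swap_mem_image_swap: "prod.swap t \<in> prod.swap ` A \<longleftrightarrow> t \<in> A"
  by (simp add: inj_image_mem_iff)

lemma upset_swap: "upset (prod.swap ` T) = prod.swap ` upset T"
proof (rule Set.set_eqI)
  fix t :: "nat \<times> nat"
  have "t \<in> upset (prod.swap ` T) \<longleftrightarrow> prod.swap t \<in> upset T"
    by (auto simp: upset_def)
  then show "t \<in> upset (prod.swap ` T) \<longleftrightarrow> t \<in> prod.swap ` upset T"
    using swap_mem_image_swap[of "prod.swap t" "upset T"] by simp
qed

lemma exp_deg_swap [simp]: "exp_deg (prod.swap t) = exp_deg t"
  by (simp add: exp_deg_def)

text \<open>In a fixed degree the exchange reverses the order of \<open>x\<close>-exponents, so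
  \<open>s\<close> and \<open>u\<close> trade places.\<close>

lemma gapfree_swap:
  assumes "gapfree d U"
  shows "gapfree d (prod.swap ` U)"
  unfolding gapfree_def
proof (intro allI impI)
  fix s t u
  assume deg: "exp_deg s = d" "exp_deg t = d" "exp_deg u = d"
    and lt: "fst s < fst t" "fst t < fst u" and su: "s \<in> prod.swap ` U" "u \<in> prod.swap ` U"
  have "prod.swap u \<in> U" "prod.swap s \<in> U" using su by auto
  moreover have "fst (prod.swap u) < fst (prod.swap t)" "fst (prod.swap t) < fst (prod.swap s)"
    using deg lt by (auto simp: exp_deg_def)
  ultimately have "prod.swap t \<in> U" using gapfreeD[OF assms] deg exp_deg_swap by metis
  then have "prod.swap (prod.swap t) \<in> prod.swap ` U" by (rule imageI)
  then show "t \<in> prod.swap ` U" by simp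
qed

text \<open>Mirror image of \<open>extend_right\<close>, with \<open>x\<close> in place of
  \<open>y\<close> as the colon variable.\<close>

lemma extend_left:
  assumes gap_M: "gapfree e (upset M)" and gap_P: "gapfree e (upset P)" and "P \<subseteq> M"
    and rest: "\<And>m. m \<in> M - P \<Longrightarrow> e \<le> exp_deg m" and deg_P: "\<And>r. r \<in> P \<Longrightarrow> exp_deg r \<le> e"
    and p: "p \<in> upset P" "exp_deg p = e"
    and a: "a \<in> M" "a \<notin> upset P" "exp_deg a = e" and "fst a < fst p"
  obtains h where "h \<in> M" "h \<notin> P" "exp_deg h = e" "gapfree e (upset (insert h P))"
    "\<And>s. s + h \<in> upset P \<longleftrightarrow> 1 \<le> fst s"
proof -
  obtain h where h: "h \<in> prod.swap ` M" "h \<notin> prod.swap ` P" "exp_deg h = e"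
    "gapfree e (upset (insert h (prod.swap ` P)))"
    "\<And>s. s + h \<in> upset (prod.swap ` P) \<longleftrightarrow> 1 \<le> snd s"
  proof (rule extend_right[of e "prod.swap ` M" "prod.swap ` P" "prod.swap p" "prod.swap a"])
    show "gapfree e (upset (prod.swap ` M))" "gapfree e (upset (prod.swap ` P))"
      using gap_M gap_P by (simp_all add: upset_swap gapfree_swap)
    show "fst (prod.swap p) < fst (prod.swap a)"
      using p a \<open>fst a < fst p\<close> by (auto simp: exp_deg_def)
    show "e \<le> exp_deg m" if "m \<in> prod.swap ` M - prod.swap ` P" for m
      using that rest by (metis Diff_iff imageE exp_deg_swap imageI)
    show "exp_deg r \<le> e" if "r \<in> prod.swap ` P" for r
      using that deg_P by (metis imageE exp_deg_swap)
  qed (use p a \<open>P \<subseteq> M\<close> in \<open>auto simp: upset_swap swap_mem_image_swap\<close>)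
  define g where "g = prod.swap h"
  have h_eq: "h = prod.swap g" by (simp add: g_def)
  show ?thesis
  proof (rule that[of g])
    show "g \<in> M" "g \<notin> P" "exp_deg g = e" using h(1-3) by (auto simp: h_eq swap_mem_image_swap)
    have "upset (insert h (prod.swap ` P)) = prod.swap ` upset (insert g P)"
      by (simp add: h_eq flip: upset_swap)
    with h(4) have "gapfree e (prod.swap ` (prod.swap ` upset (insert g P)))"
      by (simp add: gapfree_swap)
    then show "gapfree e (upset (insert g P))" by (simp add: image_image)
    show "s + g \<in> upset P \<longleftrightarrow> 1 \<le> fst s" for s
    proof -
      have "prod.swap s + h = prod.swap (s + g)" by (simp add: h_eq prod_eq_iff)
      then show ?thesis using h(5)[of "prod.swap s"] by (simp add: upset_swap swap_mem_image_swap)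
    qed
  qed
qed

section \<open>Minimal generators as antichains\<close>

definition exp_antichain :: "(nat \<times> nat) set \<Rightarrow> bool" where
  "exp_antichain M \<longleftrightarrow> (\<forall>s\<in>M. \<forall>t\<in>M. fst s \<le> fst t \<longrightarrow> snd s \<le> snd t \<longrightarrow> s = t)"

lemma exp_antichain_not_in_upset:
  "exp_antichain M \<Longrightarrow> P \<subseteq> M \<Longrightarrow> m \<in> M \<Longrightarrow> m \<notin> P \<Longrightarrow> m \<notin> upset P"
  unfolding exp_antichain_def upset_def by blast

text \<open>Dickson's lemma for two variables: each coordinate is injective on an antichain, and
  against a fixed \<open>m\<close> every element is bounded in one of them.\<close>

lemma finite_exp_antichain:
  assumes "exp_antichain M"
  shows "finite M"
proof (cases "M = {}")
  case False
  then obtain m where m: "m \<in> M" by auto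
  have "inj_on fst M" "inj_on snd M"
    using assms unfolding inj_on_def exp_antichain_def by (metis nat_le_linear)+
  then have inj: "inj_on fst {t\<in>M. fst t \<le> fst m}" "inj_on snd {t\<in>M. snd t \<le> snd m}"
    by (auto elim: inj_on_subset)
  have "finite (fst ` {t\<in>M. fst t \<le> fst m})" "finite (snd ` {t\<in>M. snd t \<le> snd m})"
    by (auto intro: finite_subset[of _ "{..fst m}"] finite_subset[of _ "{..snd m}"])
  then have "finite ({t\<in>M. fst t \<le> fst m} \<union> {t\<in>M. snd t \<le> snd m})"
    using inj by (auto dest: finite_imageD)
  moreover have "M \<subseteq> {t\<in>M. fst t \<le> fst m} \<union> {t\<in>M. snd t \<le> snd m}"
    using assms m by (fastforce simp: exp_antichain_def)
  ultimately show ?thesis by (rule rev_finite_subset)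
qed simp

text \<open>Take the elements of \<open>T\<close> minimal under divisibility; descent on the degree
  reaches one below every element.\<close>

lemma exists_exp_antichain:
  obtains M where "exp_antichain M" "upset M = upset T"
proof
  let ?M = "{t\<in>T. \<forall>s\<in>T. fst s \<le> fst t \<longrightarrow> snd s \<le> snd t \<longrightarrow> s = t}"
  show "exp_antichain ?M" by (auto simp: exp_antichain_def)
  have "t \<in> upset ?M" if "t \<in> T" for t
    using that
  proof (induction "exp_deg t" arbitrary: t rule: less_induct)
    case less
    show ?case
    proof (cases "t \<in> ?M")
      case True
      then show ?thesis by (rule subsetD[OF subset_upset])
    next
      case False
      then obtain s where s: "s \<in> T" "fst s \<le> fst t" "snd s \<le> snd t" "s \<noteq> t"
        using less.prems by blast
      then have "exp_deg s < exp_deg t" by (auto simp: exp_deg_def prod_eq_iff)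
      then show ?thesis using less.hyps s upset_closed by blast
    qed
  qed
  then have "upset T \<subseteq> upset (upset ?M)" by (intro upset_mono) auto
  then show "upset ?M = upset T"
    using upset_mono[of ?M T] by (auto simp: upset_idem)
qed

section \<open>Ordering the generators\<close>

text \<open>One step of the ordering: pass to the least degree \<open>e\<close> of a remaining
  generator, where \<open>P\<close> still spans an interval, and extend that interval on the side of
  this generator.\<close>

lemma extend:
  assumes anti: "exp_antichain M" and gap_M: "\<And>e. gapfree e (upset M)"
    and P: "P \<subseteq> M" "P \<noteq> {}" "P \<noteq> M"
    and rest: "\<And>m. m \<in> M - P \<Longrightarrow> d \<le> exp_deg m" and deg_P: "\<And>r. r \<in> P \<Longrightarrow> exp_deg r \<le> d"
    and gap_P: "gapfree d (upset P)"
  obtains h where "h \<in> M" "h \<notin> P" "\<And>m. m \<in> M - P \<Longrightarrow> exp_deg h \<le> exp_deg m"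
    "gapfree (exp_deg h) (upset (insert h P))"
    "(\<forall>s. s + h \<in> upset P \<longleftrightarrow> 1 \<le> fst s) \<or> (\<forall>s. s + h \<in> upset P \<longleftrightarrow> 1 \<le> snd s)"
proof -
  obtain a where a: "a \<in> M - P" and min: "\<And>m. m \<in> M - P \<Longrightarrow> exp_deg a \<le> exp_deg m"
    using ex_has_least_nat[of "\<lambda>t. t \<in> M - P" _ exp_deg] P by blast
  define e where "e = exp_deg a"
  have "d \<le> e" using rest a by (simp add: e_def)
  have gap: "gapfree e (upset P)" using gapfree_upset_mono[OF \<open>d \<le> e\<close> gap_P deg_P] .
  have deg_e: "exp_deg r \<le> e" if "r \<in> P" for r using deg_P that \<open>d \<le> e\<close> le_trans by blast
  obtain r where r: "r \<in> P" using P by auto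
  \<comment> \<open>A multiple of \<open>r\<close> by a power of \<open>y\<close>, giving a point of
    the interval in degree \<open>e\<close>.\<close>
  define p where "p = (fst r, e - fst r)"
  have p: "p \<in> upset P" "exp_deg p = e"
    using r deg_e[OF r] by (auto simp: p_def upset_def exp_deg_def)
  have a': "a \<notin> upset P" "a \<in> M" "exp_deg a = e"
    using exp_antichain_not_in_upset[OF anti P(1)] a by (auto simp: e_def)
  have rest_e: "e \<le> exp_deg m" if "m \<in> M - P" for m using min that by (simp add: e_def)
  have "fst a \<noteq> fst p" using exp_deg_eqI[of a p] p a' by auto
  then consider "fst p < fst a" | "fst a < fst p" by linarith
  then show ?thesis
  proof cases
    case 1
    obtain h where "h \<in> M" "h \<notin> P" "exp_deg h = e" "gapfree e (upset (insert h P))"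
      "\<And>s. s + h \<in> upset P \<longleftrightarrow> 1 \<le> snd s"
      using extend_right[OF gap_M gap P(1) rest_e deg_e p a'(2,1,3) 1] by metis
    then show ?thesis using that[of h] rest_e by auto
  next
    case 2
    obtain h where "h \<in> M" "h \<notin> P" "exp_deg h = e" "gapfree e (upset (insert h P))"
      "\<And>s. s + h \<in> upset P \<longleftrightarrow> 1 \<le> fst s"
      using extend_left[OF gap_M gap P(1) rest_e deg_e p a'(2,1,3) 2] by metis
    then show ?thesis using that[of h] rest_e by auto
  qed
qed

text \<open>The colon condition on exponents, as provided by \<open>ideal_colon_mon\<close>; the two
  right-hand sides describe \<open>(x)\<close> and \<open>(y)\<close>. Lists count from 0, so
  \<open>ts ! j\<close> is the generator following the first \<open>j\<close>.\<close>

definition variable_colons :: "(nat \<times> nat) list \<Rightarrow> bool" where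
  "variable_colons ts \<longleftrightarrow> (\<forall>j. 1 \<le> j \<and> j < length ts \<longrightarrow>
     (\<forall>s. s + ts ! j \<in> upset (set (take j ts)) \<longleftrightarrow> 1 \<le> fst s) \<or>
     (\<forall>s. s + ts ! j \<in> upset (set (take j ts)) \<longleftrightarrow> 1 \<le> snd s))"

lemma variable_colons_snoc:
  assumes "variable_colons ts"
    and "(\<forall>s. s + h \<in> upset (set ts) \<longleftrightarrow> 1 \<le> fst s) \<or> (\<forall>s. s + h \<in> upset (set ts) \<longleftrightarrow> 1 \<le> snd s)"
  shows "variable_colons (ts @ [h])"
  unfolding variable_colons_def
proof (intro allI impI)
  fix j assume j: "1 \<le> j \<and> j < length (ts @ [h])"
  show "(\<forall>s. s + (ts @ [h]) ! j \<in> upset (set (take j (ts @ [h]))) \<longleftrightarrow> 1 \<le> fst s) \<or>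
     (\<forall>s. s + (ts @ [h]) ! j \<in> upset (set (take j (ts @ [h]))) \<longleftrightarrow> 1 \<le> snd s)"
  proof (cases "j < length ts")
    case True
    with assms(1) j show ?thesis by (simp add: variable_colons_def nth_append)
  next
    case False
    with j have "j = length ts" by simp
    with assms(2) show ?thesis by simp
  qed
qed

lemma exists_variable_colons_ordering:
  assumes anti: "exp_antichain M" and gap_M: "\<And>e. gapfree e (upset M)"
  obtains ts where "set ts = M" "distinct ts" "sorted (map exp_deg ts)" "variable_colons ts"
proof (cases "M = {}")
  case True
  then show ?thesis using that[of "[]"] by (simp add: variable_colons_def)
next
  case False
  have fin: "finite M" by (rule finite_exp_antichain[OF anti])
  \<comment> \<open>The degree \<open>d\<close> separates the generators taken from those remaining,
    which keeps the list sorted when one is appended.\<close>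
  define good where "good ts \<longleftrightarrow> set ts \<subseteq> M \<and> distinct ts \<and> sorted (map exp_deg ts) \<and>
    variable_colons ts \<and> (\<exists>d. (\<forall>r\<in>set ts. exp_deg r \<le> d) \<and> (\<forall>m\<in>M - set ts. d \<le> exp_deg m) \<and>
      gapfree d (upset (set ts)))" for ts
  have "\<exists>ts. length ts = n \<and> good ts" if "1 \<le> n" "n \<le> card M" for n
    using that
  proof (induction n rule: nat_induct_at_least)
    case base
    obtain a where a: "a \<in> M" and min: "\<And>m. m \<in> M \<Longrightarrow> exp_deg a \<le> exp_deg m"
      using ex_has_least_nat[of "\<lambda>t. t \<in> M" _ exp_deg] False by blast
    \<comment> \<open>In its own degree, \<open>a\<close> has no multiple but itself.\<close>
    have "gapfree (exp_deg a) (upset {a})"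
      by (auto simp: gapfree_def upset_def exp_deg_def)
    with a min have "good [a]" unfolding good_def
      by (intro conjI exI[of _ "exp_deg a"]) (auto simp: variable_colons_def)
    then show ?case by (intro exI[of _ "[a]"]) simp
  next
    case (Suc n)
    then obtain ts where ts: "length ts = n" "good ts" by auto
    then obtain d where d: "\<And>r. r \<in> set ts \<Longrightarrow> exp_deg r \<le> d"
      "\<And>m. m \<in> M - set ts \<Longrightarrow> d \<le> exp_deg m" "gapfree d (upset (set ts))"
      by (auto simp: good_def)
    have ts_M: "set ts \<subseteq> M" and dist: "distinct ts" and sort: "sorted (map exp_deg ts)"
      and colons: "variable_colons ts" using ts by (auto simp: good_def)
    have "card (set ts) = n" using dist ts distinct_card by blast
    then have "set ts \<noteq> {}" "set ts \<noteq> M" using Suc by auto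
    then obtain h where h: "h \<in> M" "h \<notin> set ts"
      "\<And>m. m \<in> M - set ts \<Longrightarrow> exp_deg h \<le> exp_deg m"
      "gapfree (exp_deg h) (upset (insert h (set ts)))"
      "(\<forall>s. s + h \<in> upset (set ts) \<longleftrightarrow> 1 \<le> fst s) \<or> (\<forall>s. s + h \<in> upset (set ts) \<longleftrightarrow> 1 \<le> snd s)"
      using extend[OF anti gap_M ts_M _ _ d(2,1,3)] by metis
    have le: "exp_deg r \<le> exp_deg h" if "r \<in> set ts" for r
      using d(1)[OF that] d(2)[of h] h(1,2) by simp
    have "good (ts @ [h])" unfolding good_def
    proof (intro conjI exI[of _ "exp_deg h"])
      show "variable_colons (ts @ [h])" by (rule variable_colons_snoc[OF colons h(5)])
    qed (use ts_M dist sort h le in \<open>auto simp: sorted_append\<close>)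
    then show ?case using ts by (intro exI[of _ "ts @ [h]"]) simp
  qed
  moreover have "1 \<le> card M" using fin False by (simp add: Suc_le_eq card_gt_0_iff)
  ultimately obtain ts where ts: "length ts = card M" "good ts" by blast
  then have "set ts = M"
    using fin by (intro card_subset_eq) (auto simp: good_def distinct_card)
  with ts show ?thesis using that by (auto simp: good_def)
qed

section \<open>Return to polynomials\<close>

text \<open>A proper subset misses some \<open>m\<close>, which no other element of the antichain
  divides, so the ideal shrinks.\<close>

lemma minimal_monomial_generators_antichain:
  assumes "exp_antichain M" and "ideal_of (mon ` M) = (I :: 'k::field poly2 set)"
  shows "minimal_monomial_generators I (mon ` M)"
  unfolding minimal_monomial_generators_def
proof (intro conjI allI impI)
  fix G assume "G \<subset> (mon ` M :: 'k poly2 set)"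
  then obtain P where P: "P \<subset> M" "G = mon ` P" by (metis subset_image_iff psubset_eq)
  then obtain m where "m \<in> M" "m \<notin> P" by blast
  then have "m \<in> upset M" "m \<notin> upset P"
    using exp_antichain_not_in_upset[OF assms(1)] P subset_upset by blast+
  then show "ideal_of G \<noteq> I"
    using ideal_of_mon_eq_iff[of P M] assms(2) P(2) by blast
qed (use assms in auto)

theorem theorem1p3:
  fixes I :: "'k::field poly2 set"
  assumes "infinite (UNIV :: 'k set)"
    and "monomial_ideal I"
    and "I \<noteq> {0}"
    and "componentwise_linear I"
  shows "\<exists>fs. distinct fs \<and> minimal_monomial_generators I (set fs) \<and>
           sorted (map total_deg fs) \<and>
           (\<forall>j. 1 \<le> j \<and> j \<le> length fs - 1 \<longrightarrow>
              (\<exists>z \<in> {var_x, var_y}.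
                 ideal_colon (ideal_of (set (take j fs))) (fs ! j) = ideal_of {z}))"
proof -
  obtain T where T: "I = ideal_of (mon ` T)" using assms(2) by (auto simp: monomial_ideal_def)
  obtain M where M: "exp_antichain M" "upset M = upset T" by (rule exists_exp_antichain)
  then have I: "I = ideal_of (mon ` M)" by (simp add: T ideal_of_mon)
  have gap: "gapfree e (upset M)" for e
  proof -
    have "has_linear_resolution (degree_component_ideal I e)"
      using assms(4) by (simp add: componentwise_linear_def)
    then have "gapfree e {t \<in> upset M. exp_deg t = e}"
      unfolding I degree_component_ideal_mon by (intro gapfree_if_linear_resolution[OF refl]) auto
    \<comment> \<open>\<open>gapfree e\<close> sees only monomials of degree
      \<open>e\<close>.\<close>
    then show ?thesis by (auto simp: gapfree_def)
  qed
  obtain ts where ts: "set ts = M" "distinct ts" "sorted (map exp_deg ts)" "variable_colons ts"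
    by (rule exists_variable_colons_ordering[OF M(1) gap])
  define fs where "fs = map (mon :: _ \<Rightarrow> 'k poly2) ts"
  have vars: "ideal_of {var_x} = {g :: 'k poly2. \<forall>s\<in>Poly_Mapping.keys g. 1 \<le> fst s}"
    "ideal_of {var_y} = {g :: 'k poly2. \<forall>s\<in>Poly_Mapping.keys g. 1 \<le> snd s}"
    using ideal_of_mon[of "{(1, 0)}", where 'k = 'k] ideal_of_mon[of "{(0, 1)}", where 'k = 'k]
    by (auto simp: var_x_def var_y_def upset_def)
  have "\<exists>z \<in> {var_x, var_y}. ideal_colon (ideal_of (set (take j fs))) (fs ! j) = ideal_of {z}"
    if "1 \<le> j" "j \<le> length fs - 1" for j
  proof -
    \<comment> \<open>Since \<open>1 \<le> j\<close>, the truncated difference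
      \<open>length fs - 1\<close> is positive and \<open>j\<close> is a valid index.\<close>
    have j: "1 \<le> j \<and> j < length ts" using that by (auto simp: fs_def)
    then have "ideal_colon (ideal_of (set (take j fs))) (fs ! j) =
        {g. \<forall>s\<in>Poly_Mapping.keys g. s + ts ! j \<in> upset (set (take j ts))}"
      by (simp add: fs_def take_map ideal_colon_mon)
    then show ?thesis using ts(4) j unfolding variable_colons_def by (fastforce simp: vars)
  qed
  moreover have "distinct fs" using ts inj_mon by (auto simp: fs_def distinct_map intro: inj_on_subset)
  moreover have "minimal_monomial_generators I (set fs)"
    using minimal_monomial_generators_antichain[OF M(1) I[symmetric]] ts by (simp add: fs_def)
  moreover have "sorted (map total_deg fs)" using ts by (simp add: fs_def o_def)
  ultimately show ?thesis by blast
qed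

end
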